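(* Let $G$ be a connected graph with $\Delta(G)\geq 3$ and let $m\in\mathbb{N}$. Then $\chi(G^{\frac{m}{m+1}})=\omega(G^{\frac{m}{m+1}})$.
   Context: All graphs are finite and simple; $\Delta$ is the maximum degree, $\chi$ the chromatic number, $\omega$ the clique number. For a graph $H$ and $m\in\mathbb{N}$, the $m$-power $H^m$ has vertex set $V(H)$, with distinct vertices $x,y$ adjacent iff $1\le d_H(x,y)\le m$. For $n\in\mathbb{N}$, the $n$-subdivision $G^{\frac1n}$ is obtained from $G$ by replacing each edge by a path of length $n$. The fractional power $G^{\frac{m}{n}}$ is $(G^{\frac1n})^m$. *)

theory Defs
  imports "Graph_Theory.Graph_Theory"
begin

text \<open>
  Finite simple graphs are represented by the locale \<^locale>\<open>pair_graph\<close>: an edge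
  \<open>uv\<close> is the pair of opposite arcs \<open>(u,v)\<close>, \<open>(v,u)\<close>. Hence the out-degree
  of a vertex is its degree in the undirected sense.
\<close>

definition max_degree :: "'a pair_pre_digraph \<Rightarrow> nat" where
  "max_degree G = Max (out_degree (with_proj G) ` pverts G)"

definition proper_coloring :: "'a pair_pre_digraph \<Rightarrow> nat \<Rightarrow> ('a \<Rightarrow> nat) \<Rightarrow> bool" where
  "proper_coloring G k c \<longleftrightarrow>
     (\<forall>v \<in> pverts G. c v < k) \<and> (\<forall>(u, v) \<in> parcs G. c u \<noteq> c v)"

definition chromatic_number :: "'a pair_pre_digraph \<Rightarrow> nat" where
  "chromatic_number G = (LEAST k. \<exists>c. proper_coloring G k c)"

definition clique :: "'a pair_pre_digraph \<Rightarrow> 'a set \<Rightarrow> bool" where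
  "clique G S \<longleftrightarrow>
     S \<subseteq> pverts G \<and> (\<forall>u \<in> S. \<forall>v \<in> S. u \<noteq> v \<longrightarrow> (u, v) \<in> parcs G)"

definition clique_number :: "'a pair_pre_digraph \<Rightarrow> nat" where
  "clique_number G = Max (card ` {S. clique G S})"

text \<open>
  The minimum cost of a walk with unit arc costs; it is \<open>\<infinity>\<close> if there is no walk.
\<close>

definition graph_dist :: "'a pair_pre_digraph \<Rightarrow> 'a \<Rightarrow> 'a \<Rightarrow> ereal" where
  "graph_dist H x y = wf_digraph.\<mu> (with_proj H) (\<lambda>_. 1) x y"

definition graph_power :: "'a pair_pre_digraph \<Rightarrow> nat \<Rightarrow> 'a pair_pre_digraph" where
  "graph_power H m =
     \<lparr> pverts = pverts H,
       parcs = {(x, y). x \<in> pverts H \<and> y \<in> pverts H \<and> x \<noteq> y \<and>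
                        1 \<le> graph_dist H x y \<and> graph_dist H x y \<le> ereal (real m)} \<rparr>"

text \<open>
  Vertices of the \<open>n\<close>-subdivision. The point at distance \<open>i\<close> from \<open>u\<close> on the path
  of length \<open>n\<close> replacing the edge \<open>uv\<close> is \<open>u\<close> for \<open>i = 0\<close>, \<open>v\<close> for \<open>i = n\<close>, and
  otherwise a new vertex, encoded by the set \<open>{(u, i), (v, n - i)}\<close> of the two ends of the
  edge together with the distances to them. Thus traversing the edge from \<open>v\<close> to \<open>u\<close> gives
  the same \<open>n - 1\<close> inner vertices (lemma \<open>sub_point_flip\<close>).
\<close>

datatype 'a sub_vertex = Branch 'a | Inner "('a \<times> nat) set"

definition sub_point :: "nat \<Rightarrow> 'a \<Rightarrow> 'a \<Rightarrow> nat \<Rightarrow> 'a sub_vertex" where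
  "sub_point n u v i =
     (if i = 0 then Branch u else if i = n then Branch v else Inner {(u, i), (v, n - i)})"

text \<open>
  As \<open>(u,v)\<close> ranges over both arcs of an edge, each step of the path is present in both
  directions.
\<close>

definition subdivision_graph :: "'a pair_pre_digraph \<Rightarrow> nat \<Rightarrow> 'a sub_vertex pair_pre_digraph" where
  "subdivision_graph G n =
     \<lparr> pverts = Branch ` pverts G \<union>
                {sub_point n u v i | u v i. (u, v) \<in> parcs G \<and> 0 < i \<and> i < n},
       parcs = {(sub_point n u v i, sub_point n u v (Suc i)) | u v i.
                  (u, v) \<in> parcs G \<and> i < n} \<rparr>"

definition fractional_power ::
    "'a pair_pre_digraph \<Rightarrow> nat \<Rightarrow> nat \<Rightarrow> 'a sub_vertex pair_pre_digraph" where
  "fractional_power G m n = graph_power (subdivision_graph G n) m"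

lemma sub_point_flip:
  assumes "i \<le> n" "0 < n"
  shows "sub_point n v u (n - i) = sub_point n u v i"
  using assms by (auto simp: sub_point_def)

lemma sub_point_inj:
  assumes "u \<noteq> v" "x \<noteq> y" "0 < i" "i < n" "0 < j" "j < n"
  shows "sub_point n u v i = sub_point n x y j \<longleftrightarrow>
           (x = u \<and> y = v \<and> j = i) \<or> (x = v \<and> y = u \<and> j = n - i)"
  using assms by (auto simp: sub_point_def doubleton_eq_iff)

lemma pair_graph_subdivision_graph:
  assumes "pair_graph G"
  shows "pair_graph (subdivision_graph G n)"
proof -
  interpret G: pair_graph G by fact
  let ?S = "subdivision_graph G n"
  have sym: "(v, u) \<in> parcs G" if "(u, v) \<in> parcs G" for u v
    using G.sym_arcs that by (auto simp: symmetric_def dest: symD)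
  have pt: "sub_point n u v i \<in> pverts ?S" if "(u, v) \<in> parcs G" "i \<le> n" for u v i
  proof -
    consider "i = 0" | "0 < i" "i = n" | "0 < i" "i < n"
      using \<open>i \<le> n\<close> by linarith
    then show ?thesis
    proof cases
      case 3
      then show ?thesis using that by (simp add: subdivision_graph_def) blast
    qed (use G.in_arcsD1[OF that(1)] G.in_arcsD2[OF that(1)] in
          \<open>simp_all add: subdivision_graph_def sub_point_def\<close>)
  qed
  have arcs: "parcs ?S = (\<lambda>((u, v), i). (sub_point n u v i, sub_point n u v (Suc i))) `
                (parcs G \<times> {..<n})"
    by (force simp: subdivision_graph_def)
  have verts: "pverts ?S = Branch ` pverts G \<union>
                 (\<lambda>((u, v), i). sub_point n u v i) ` (parcs G \<times> {0<..<n})"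
    by (force simp: subdivision_graph_def)
  show ?thesis
  proof
    fix e assume "e \<in> parcs ?S"
    then obtain u v i where e: "(u, v) \<in> parcs G" "i < n"
      "e = (sub_point n u v i, sub_point n u v (Suc i))"
      by (auto simp: arcs)
    show "fst e \<in> pverts ?S" "snd e \<in> pverts ?S"
      using e pt by auto
    have "u \<noteq> v" using G.pair_no_loops[OF e(1)] by simp
    then show "fst e \<noteq> snd e"
      using e(2,3) by (auto simp: sub_point_def doubleton_eq_iff)
  next
    show "finite (pverts ?S)" "finite (parcs ?S)"
      using G.pair_finite_verts G.pair_finite_arcs by (auto simp: arcs verts)
  next
    have "(y, x) \<in> parcs ?S" if xy: "(x, y) \<in> parcs ?S" for x y
    proof -
      obtain u v i where e: "(u, v) \<in> parcs G" "i < n"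
        "x = sub_point n u v i" "y = sub_point n u v (Suc i)"
        using xy by (auto simp: arcs)
      have "y = sub_point n v u (n - Suc i)" "x = sub_point n v u (Suc (n - Suc i))"
        using e sub_point_flip[of "Suc i" n v u] sub_point_flip[of i n v u]
        by (simp_all add: Suc_diff_Suc)
      moreover have "(v, u) \<in> parcs G" "n - Suc i < n" using e sym by auto
      ultimately show ?thesis by (force simp: arcs)
    qed
    then show "symmetric (with_proj ?S)"
      by (auto simp: symmetric_def intro: symI)
  qed
qed

end

theory Submission
  imports Defs
begin

text \<open>
  Put \<open>k = m div 2\<close> and let \<open>\<Delta>\<close> be the maximum degree. The points at distance at most \<open>k\<close>
  from a vertex of degree \<open>\<Delta>\<close>, together with one midpoint if \<open>m\<close> is odd, form a clique with
  \<open>1 + m mod 2 + k * \<Delta>\<close> elements. For a colouring with as many colours, give one colour to all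
  branch vertices and, for odd \<open>m\<close>, one to all midpoints; split the others into \<open>k\<close> blocks of
  size \<open>\<Delta>\<close> and use the \<open>i\<close>-th block for the points at distance \<open>i\<close> from their nearer end.
  Points \<open>i\<close> steps from \<open>u\<close> on \<open>uv\<close> and \<open>j\<close> steps from \<open>w\<close> on \<open>wu\<close>, with \<open>v \<noteq> w\<close> and
  \<open>i, j \<le> k\<close>, are adjacent only if \<open>i < j\<close>, so they lie in different blocks. Hence a colouring
  \<open>f\<close> of the half-edges by \<open>\<Delta>\<close> colours suffices in each block, where the half-edges at a vertex
  have distinct colours and the two halves of an edge differ.
\<close>

section \<open>Balanced orientations of multigraphs and graphs\<close>

definition ends :: "'v \<times> 'v \<Rightarrow> 'v set" where
  "ends a = {fst a, snd a}"

text \<open>Edges are names \<open>e\<close> placed by \<open>h\<close>, so that parallel edges and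
  loops, which arise when edges are merged, are allowed. A loop contributes 0.\<close>

definition out_excess :: "'e set \<Rightarrow> ('e \<Rightarrow> 'v \<times> 'v) \<Rightarrow> 'v \<Rightarrow> int" where
  "out_excess F h w = (\<Sum>e\<in>F. of_bool (fst (h e) = w) - of_bool (snd (h e) = w))"

text \<open>Two edges \<open>xv\<close> and \<open>vy\<close> are replaced by one edge \<open>xy\<close>; a balanced orientation of the
  smaller multigraph (loops allowed) gives one in which \<open>v\<close> is entered once and left once more.\<close>

lemma balanced_orientation_multigraph:
  fixes F :: "'e set" and p :: "'e \<Rightarrow> 'v \<times> 'v"
  assumes "finite F"
  shows "\<exists>h. (\<forall>e\<in>F. h e = p e \<or> h e = prod.swap (p e)) \<and> (\<forall>w. \<bar>out_excess F h w\<bar> \<le> 1)"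
  using assms
proof (induction "card F" arbitrary: F p rule: less_induct)
  case less
  show ?case
  proof (cases "\<exists>e\<in>F. \<exists>e'\<in>F. e \<noteq> e' \<and> ends (p e) \<inter> ends (p e') \<noteq> {}")
    case True
    then obtain e e' v where e: "e \<in> F" "e' \<in> F" "e \<noteq> e'" "v \<in> ends (p e)" "v \<in> ends (p e')"
      by blast
    obtain x where x: "p e = (x, v) \<or> p e = (v, x)"
      using e(4) by (cases "p e") (auto simp: ends_def)
    obtain y where y: "p e' = (v, y) \<or> p e' = (y, v)"
      using e(5) by (cases "p e'") (auto simp: ends_def)
    define F' where "F' = F - {e'}"
    have "card F' < card F" "finite F'"
      using card_Diff1_less[OF less.prems e(2)] less.prems by (simp_all add: F'_def)
    from less.hyps[OF this, of "p(e := (x, y))"] obtain h where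
      h: "\<And>a. a \<in> F' \<Longrightarrow> h a = (p(e := (x, y))) a \<or> h a = prod.swap ((p(e := (x, y))) a)"
         "\<And>w. \<bar>out_excess F' h w\<bar> \<le> 1"
      by blast
    \<comment> \<open>The arc that replaced the two edges is routed through \<open>v\<close> again,
      in the direction that \<open>h\<close> gave it. If \<open>x = y\<close> it is a loop and
      either direction serves.\<close>
    define g where "g = (if h e = (x, y) then h(e := (x, v), e' := (v, y))
                         else h(e := (v, x), e' := (y, v)))"
    have he: "h e = (x, y) \<or> h e = (y, x)"
      using h(1)[of e] e by (auto simp: F'_def)
    have "g a = p a \<or> g a = prod.swap (p a)" if "a \<in> F" for a
      using that h(1)[of a] x y e by (auto simp: g_def F'_def split: if_splits)
    moreover have "out_excess F g w = out_excess F' h w" for w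
    proof -
      define R where "R = F - {e, e'}"
      have R: "finite R" "e \<notin> R" "e' \<notin> R" "F = insert e (insert e' R)" "F' = insert e R"
        using e less.prems by (auto simp: R_def F'_def)
      have "out_excess R g w = out_excess R h w"
        unfolding out_excess_def using R by (intro sum.cong) (auto simp: g_def)
      moreover have "out_excess F g w = (of_bool (fst (g e) = w) - of_bool (snd (g e) = w))
          + (of_bool (fst (g e') = w) - of_bool (snd (g e') = w)) + out_excess R g w"
        using R e by (simp add: out_excess_def)
      moreover have "out_excess F' h w = (of_bool (fst (h e) = w) - of_bool (snd (h e) = w))
          + out_excess R h w"
        using R by (simp add: out_excess_def)
      moreover have "h e = (x, y) \<and> g e = (x, v) \<and> g e' = (v, y)
          \<or> h e = (y, x) \<and> g e = (v, x) \<and> g e' = (y, v)"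
        using he e by (auto simp: g_def)
      ultimately show ?thesis by (elim disjE conjE) simp_all
    qed
    ultimately show ?thesis using h(2) by (intro exI[of _ g]) auto
  next
    case False
    \<comment> \<open>Every vertex now meets at most one edge, so any orientation is balanced;
      \<open>p\<close> itself is taken.\<close>
    have "\<bar>out_excess F p w\<bar> \<le> 1" for w
    proof (cases "\<exists>e\<in>F. w \<in> ends (p e)")
      case True
      then obtain e where e: "e \<in> F" "w \<in> ends (p e)" by blast
      have "w \<notin> ends (p a)" if "a \<in> F - {e}" for a
        using False e that by blast
      then have "out_excess (F - {e}) p w = 0"
        unfolding out_excess_def by (intro sum.neutral) (auto simp: ends_def)
      moreover have "out_excess F p w
          = (of_bool (fst (p e) = w) - of_bool (snd (p e) = w)) + out_excess (F - {e}) p w"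
        unfolding out_excess_def using e less.prems by (simp add: sum.remove)
      ultimately show ?thesis by auto
    next
      case 2: False
      then have "out_excess F p w = 0"
        unfolding out_excess_def by (intro sum.neutral) (auto simp: ends_def)
      then show ?thesis by simp
    qed
    then show ?thesis by (intro exI[of _ p]) auto
  qed
qed

lemma out_excess_inj:
  fixes h :: "'e \<Rightarrow> 'v \<times> 'v"
  assumes "finite F" "inj_on h F"
  shows "out_excess F h w = int (card {v. (w, v) \<in> h ` F}) - int (card {u. (u, w) \<in> h ` F})"
proof -
  have 1: "(\<Sum>a\<in>D. of_bool (fst a = w)) = int (card {v. (w, v) \<in> D})"
    "(\<Sum>a\<in>D. of_bool (snd a = w)) = int (card {u. (u, w) \<in> D})"
    if "finite D" for D :: "('v \<times> 'v) set"
  proof -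
    have "card (D \<inter> {a. fst a = w}) = card {v. (w, v) \<in> D}"
      by (rule bij_betw_same_card[of snd]) (force simp: bij_betw_def inj_on_def)
    then show "(\<Sum>a\<in>D. of_bool (fst a = w)) = int (card {v. (w, v) \<in> D})"
      using that by (simp add: sum_of_bool_eq)
    have "card (D \<inter> {a. snd a = w}) = card {v. (v, w) \<in> D}"
      by (rule bij_betw_same_card[of fst]) (force simp: bij_betw_def inj_on_def)
    then show "(\<Sum>a\<in>D. of_bool (snd a = w)) = int (card {u. (u, w) \<in> D})"
      using that by (simp add: sum_of_bool_eq)
  qed
  have "out_excess F h w = (\<Sum>a\<in>h ` F. of_bool (fst a = w) - of_bool (snd a = w))"
    unfolding out_excess_def using assms(2) by (simp add: sum.reindex)
  also have "\<dots> = int (card {v. (w, v) \<in> h ` F}) - int (card {u. (u, w) \<in> h ` F})"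
    using 1 assms(1) by (simp add: sum_subtractf)
  finally show ?thesis .
qed

text \<open>Since \<open>B\<close> contains no opposite pair and no loop, orienting its edges
  creates neither coincident nor opposite arcs. Hence the multigraph result carries over to a set of
  arcs.\<close>

lemma balanced_orientation:
  fixes B :: "('v \<times> 'v) set"
  assumes "finite B" "B \<inter> B\<inverse> = {}"
  obtains D where "D \<subseteq> B \<union> B\<inverse>" "B \<subseteq> D \<union> D\<inverse>" "D \<inter> D\<inverse> = {}" "finite D"
    "\<And>w. \<bar>int (card {v. (w, v) \<in> D}) - int (card {u. (u, w) \<in> D})\<bar> \<le> 1"
proof -
  obtain h where h: "\<And>e. e \<in> B \<Longrightarrow> h e = e \<or> h e = prod.swap e" "\<And>w. \<bar>out_excess B h w\<bar> \<le> 1"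
    using balanced_orientation_multigraph[OF assms(1), of "\<lambda>e. e"] by blast
  have swap: "prod.swap e \<notin> B" if "e \<in> B" for e
    using that assms(2) by (cases e) auto
  have e_or: "e = e'" if "e \<in> B" "e' \<in> B" "h e = h e' \<or> h e = prod.swap (h e')" for e e'
  proof -
    have "x = y \<or> x = prod.swap y"
      if "a = x \<or> a = prod.swap x" "b = y \<or> b = prod.swap y" "a = b \<or> a = prod.swap b"
      for x y a b :: "'v \<times> 'v"
      using that by (cases x; cases y) auto
    from this[OF h(1)[OF that(1)] h(1)[OF that(2)] that(3)] have "e = e' \<or> e = prod.swap e'" .
    then show ?thesis using swap[OF that(2)] that(1) by blast
  qed
  have noswap: "h e \<noteq> prod.swap (h e')" if "e \<in> B" "e' \<in> B" for e e'
  proof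
    assume *: "h e = prod.swap (h e')"
    then have "e = e'" using e_or that by blast
    have "prod.swap x = x" if "a = x \<or> a = prod.swap x" "a = prod.swap a" for x a :: "'v \<times> 'v"
      using that by auto
    from this[OF h(1)[OF that(1)]] have "prod.swap e = e" using * \<open>e = e'\<close> by simp
    then show False using swap[OF that(1)] that(1) by simp
  qed
  have inj: "inj_on h B" using e_or by (auto simp: inj_on_def)
  show thesis
  proof (rule that[of "h ` B"])
    show "h ` B \<subseteq> B \<union> B\<inverse>" using h(1) by fastforce
    show "B \<subseteq> h ` B \<union> (h ` B)\<inverse>"
    proof
      fix e assume e: "e \<in> B"
      then have "e = h e \<or> prod.swap e = h e" using h(1)[OF e] by auto
      then show "e \<in> h ` B \<union> (h ` B)\<inverse>" using e by (cases e) (auto simp: image_iff)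
    qed
    show "h ` B \<inter> (h ` B)\<inverse> = {}"
    proof (rule ccontr)
      assume "\<not> ?thesis"
      then obtain x y where "(x, y) \<in> h ` B" "(y, x) \<in> h ` B" by auto
      then obtain e e' where e: "e \<in> B" "e' \<in> B" "(x, y) = h e" "(y, x) = h e'" by blast
      from noswap[OF e(1,2)] show False by (simp flip: e(3,4))
    qed
    show "finite (h ` B)" using assms(1) by simp
    show "\<bar>int (card {v. (w, v) \<in> h ` B}) - int (card {u. (u, w) \<in> h ` B})\<bar> \<le> 1" for w
      using h(2)[of w] out_excess_inj[OF assms(1) inj, of w] by simp
  qed
qed

section \<open>Colouring the half-edges at the vertices\<close>

text \<open>Number the finitely many vertices and keep the arcs along which the number
  grows.\<close>

lemma asym_half:
  fixes A :: "('v \<times> 'v) set"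
  assumes "finite A" "sym A" "irrefl A"
  obtains B where "A = B \<union> B\<inverse>" "B \<inter> B\<inverse> = {}"
proof -
  have "finite (Field A)" using assms(1) by (rule finite_Field)
  then obtain f :: "'v \<Rightarrow> nat" where f: "inj_on f (Field A)"
    using finite_imp_inj_to_nat_seg[of "Field A"] by blast
  show thesis
  proof (rule that[of "{(u, v) \<in> A. f u < f v}"])
    have "f u \<noteq> f v" if "(u, v) \<in> A" for u v
      using that f assms(3) by (auto simp: inj_on_def irrefl_def Field_def)
    then show "A = {(u, v) \<in> A. f u < f v} \<union> {(u, v) \<in> A. f u < f v}\<inverse>"
      using assms(2) by (auto simp: sym_def neq_iff)
  qed auto
qed

text \<open>Balancing the bipartite graph with sides of tails and of heads gives each arc to one of
  its ends, so that a vertex with at least two candidates obtains one.\<close>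

lemma arc_assignment:
  fixes D :: "('v \<times> 'v) set"
  assumes "finite D"
  obtains T where "\<And>u. card {v. (u, v) \<in> D} \<ge> 2 \<Longrightarrow> \<exists>v. (u, v) \<in> D \<inter> T"
    "\<And>v. card {u. (u, v) \<in> D} \<ge> 2 \<Longrightarrow> \<exists>u. (u, v) \<in> D - T"
proof -
  \<comment> \<open>The copies \<open>(u, True)\<close> and \<open>(v, False)\<close> separate the
    roles of tail and head, so \<open>B\<close> has no opposite arcs whatever \<open>D\<close>
    is.\<close>
  define B where "B = (\<lambda>(u, v). ((u, True), (v, False))) ` D"
  have B: "((u, s), (v, t)) \<in> B \<longleftrightarrow> (u, v) \<in> D \<and> s \<and> \<not> t" for u v s t
    by (auto simp: B_def)
  have "finite B" "B \<inter> B\<inverse> = {}" using assms by (auto simp: B_def)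
  then obtain H where H: "H \<subseteq> B \<union> B\<inverse>" "B \<subseteq> H \<union> H\<inverse>" "H \<inter> H\<inverse> = {}" "finite H"
    "\<And>w. \<bar>int (card {v. (w, v) \<in> H}) - int (card {u. (u, w) \<in> H})\<bar> \<le> 1"
    using balanced_orientation[of B] by blast
  have fin: "finite {v. (v, w) \<in> H}" for w
    by (rule finite_subset[OF _ finite_imageI[OF H(4), of fst]]) force
  \<comment> \<open>Two incident edges at \<open>w\<close> and no outgoing one would make the
    in-degree exceed the out-degree by at least two.\<close>
  have out: "\<exists>v. (w, v) \<in> H"
    if X: "card X \<ge> 2" "\<And>x. x \<in> X \<Longrightarrow> (w, g x) \<in> H \<or> (g x, w) \<in> H" "inj_on g X"
    for w X and g :: "'v \<Rightarrow> 'v \<times> bool"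
  proof (rule ccontr)
    assume no: "\<not> ?thesis"
    then have "(g x, w) \<in> H" if "x \<in> X" for x
      using X(2)[OF that] by blast
    then have "g ` X \<subseteq> {v. (v, w) \<in> H}" by (simp add: image_subset_iff)
    then have "card (g ` X) \<le> card {v. (v, w) \<in> H}" using fin by (intro card_mono)
    then have "card {v. (v, w) \<in> H} \<ge> 2" using X(1) card_image[OF X(3)] by linarith
    moreover have E: "{v. (w, v) \<in> H} = {}" using no by blast
    ultimately show False using H(5)[of w] unfolding E by simp
  qed
  have toH: "((u, True), (v, False)) \<in> H \<or> ((v, False), (u, True)) \<in> H" if "(u, v) \<in> D" for u v
    using subsetD[OF H(2), of "((u, True), (v, False))"] that by (simp add: B)
  have ofH: "((u, s), (v, t)) \<in> B \<or> ((v, t), (u, s)) \<in> B" if "((u, s), (v, t)) \<in> H" for u s v t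
    using subsetD[OF H(1) that] by simp
  show thesis
  \<comment> \<open>\<open>T\<close> collects the arcs oriented away from their tail copy: these are
    given to their tail, all others to their head.\<close>
  proof (rule that[of "{(u, v). ((u, True), (v, False)) \<in> H}"])
    fix u assume "card {v. (u, v) \<in> D} \<ge> 2"
    then have "\<exists>x. ((u, True), x) \<in> H"
      by (rule out[where g = "\<lambda>v. (v, False)"]) (simp_all add: toH inj_on_def)
    then obtain v t where vt: "((u, True), (v, t)) \<in> H" by auto
    with ofH[OF vt] have "(u, v) \<in> D" "\<not> t" by (simp_all add: B)
    with vt show "\<exists>v. (u, v) \<in> D \<inter> {(u, v). ((u, True), (v, False)) \<in> H}" by auto
  next
    fix v assume "card {u. (u, v) \<in> D} \<ge> 2"
    then have "\<exists>x. ((v, False), x) \<in> H"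
      by (rule out[where g = "\<lambda>u. (u, True)"]) (use toH in \<open>auto simp: inj_on_def\<close>)
    then obtain u t where ut: "((v, False), (u, t)) \<in> H" by auto
    with ofH[OF ut] have "(u, v) \<in> D" "t" by (simp_all add: B)
    moreover from this have "((u, True), (v, False)) \<notin> H" using H(3) ut by auto
    ultimately show "\<exists>u. (u, v) \<in> D - {(u, v). ((u, True), (v, False)) \<in> H}" by auto
  qed
qed

text \<open>Orient the edges in a balanced way. At each vertex the out-edges get colours below \<open>d div 2\<close>
  and the in-edges the next \<open>d div 2\<close> colours, so that the two halves of an edge differ. For odd
  \<open>d\<close> a vertex may have one edge too many in one direction; \<open>S\<close> contains one half-edge at each
  such vertex, which receives the remaining colour, and never both halves of an edge.\<close>

lemma half_edge_coloring:
  fixes A :: "('v \<times> 'v) set"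
  assumes "finite A" "sym A" "irrefl A" "d \<ge> 2"
    and deg: "\<And>u. card {v. (u, v) \<in> A} \<le> d"
  obtains f where "\<And>u v. (u, v) \<in> A \<Longrightarrow> f u v < d"
    "\<And>u v w. (u, v) \<in> A \<Longrightarrow> (u, w) \<in> A \<Longrightarrow> f u v = f u w \<Longrightarrow> v = w"
    "\<And>u v. (u, v) \<in> A \<Longrightarrow> f u v \<noteq> f v u"
proof -
  obtain B where B: "A = B \<union> B\<inverse>" "B \<inter> B\<inverse> = {}"
    using asym_half[OF assms(1-3)] by blast
  have "finite B" using assms(1) B(1) by simp
  then obtain D where D: "D \<subseteq> B \<union> B\<inverse>" "B \<subseteq> D \<union> D\<inverse>" "D \<inter> D\<inverse> = {}" "finite D"
    "\<And>w. \<bar>int (card {v. (w, v) \<in> D}) - int (card {u. (u, w) \<in> D})\<bar> \<le> 1"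
    using balanced_orientation[OF _ B(2)] by blast
  have A_iff: "(u, v) \<in> A \<longleftrightarrow> (u, v) \<in> D \<or> (v, u) \<in> D" for u v
    using subsetD[OF D(1), of "(u, v)"] subsetD[OF D(1), of "(v, u)"]
      subsetD[OF D(2), of "(u, v)"] subsetD[OF D(2), of "(v, u)"]
    by (auto simp: B(1))
  have asym: "(v, u) \<notin> D" if "(u, v) \<in> D" for u v
    using D(3) that by auto
  define Out where "Out u = {v. (u, v) \<in> D}" for u
  define In where "In u = {v. (v, u) \<in> D}" for u
  define r where "r = d div 2"
  have fin: "finite (Out u)" "finite (In u)" for u
    unfolding Out_def In_def
    by (rule finite_subset[OF _ finite_imageI[OF D(4), of snd]], force,
        rule finite_subset[OF _ finite_imageI[OF D(4), of fst]], force)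
  have "Out u \<inter> In u = {}" "Out u \<union> In u = {v. (u, v) \<in> A}" for u
    using asym by (auto simp: Out_def In_def A_iff)
  then have sum: "card (Out u) + card (In u) \<le> d" for u
    using deg[of u] card_Un_disjoint[OF fin(1) fin(2), of u u] by simp
  have diff: "card (Out u) \<le> card (In u) + 1" "card (In u) \<le> card (Out u) + 1" for u
    using D(5)[of u] by (simp_all add: Out_def In_def)
  have d: "d = 2 * r \<or> odd d \<and> d = 2 * r + 1"
    by (cases "even d") (auto simp: r_def)
  \<comment> \<open>Out- and in-degree differ by at most one and sum to at most \<open>d\<close>. A
    direction with more than \<open>r\<close> edges thus has exactly \<open>r + 1\<close>, the other
    one has \<open>r\<close>, and \<open>d = 2 * r + 1\<close>.\<close>
  have O_big: "odd d \<and> card (Out u) = r + 1" if "card (Out u) > r" for u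
    using d sum[of u] diff[of u] that by auto
  have I_big: "odd d \<and> card (In u) = r + 1 \<and> card (Out u) \<le> r" if "card (In u) > r" for u
    using d sum[of u] diff[of u] that by auto
  \<comment> \<open>This gives an overfull direction at least two arcs, the threshold in
    \<open>arc_assignment\<close>.\<close>
  have "r \<ge> 1" using assms(4) by (simp add: r_def)
  obtain T where T: "\<And>u. card {v. (u, v) \<in> D} \<ge> 2 \<Longrightarrow> \<exists>v. (u, v) \<in> D \<inter> T"
    "\<And>v. card {u. (u, v) \<in> D} \<ge> 2 \<Longrightarrow> \<exists>u. (u, v) \<in> D - T"
    using arc_assignment[OF D(4)] by blast
  \<comment> \<open>\<open>P u v\<close> marks the half-edges that may take the spare colour at
    \<open>u\<close>. Tails use only arcs in \<open>T\<close> and heads only arcs outside it, so the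
    two halves of an edge are never both marked.\<close>
  define P where "P u v \<longleftrightarrow> (card (Out u) > r \<and> (u, v) \<in> D \<inter> T) \<or>
    (card (In u) > r \<and> (v, u) \<in> D - T)" for u v
  define S where "S = {(u, v). P u v \<and> v = (SOME v. P u v)}"
  have S1: "v = w" if "(u, v) \<in> S" "(u, w) \<in> S" for u v w
    using that by (simp add: S_def)
  have S2: "(v, u) \<notin> S" if "(u, v) \<in> S" for u v
  proof
    assume "(v, u) \<in> S"
    then have "P u v" "P v u" using that by (auto simp: S_def)
    then show False using asym unfolding P_def by blast
  qed
  have S_odd: "odd d" if "(u, v) \<in> S" for u v
    using that O_big I_big unfolding S_def P_def by blast
  have S_ex: "\<exists>v. (u, v) \<in> S \<and> P u v" if "P u w" for u w
    using someI[of "P u", OF that] by (auto simp: S_def)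
  have cardO: "card (Out u - S `` {u}) \<le> r" for u
  proof (cases "card (Out u) > r")
    case True
    then have "\<not> card (In u) > r" using O_big[of u] I_big[of u] by auto
    have "card {v. (u, v) \<in> D} \<ge> 2" using O_big[OF True] \<open>r \<ge> 1\<close> by (simp add: Out_def)
    from T(1)[OF this] obtain w where "P u w" using True by (auto simp: P_def)
    from S_ex[OF this] obtain v where v: "(u, v) \<in> S" "P u v" by blast
    then have "v \<in> Out u" using \<open>\<not> card (In u) > r\<close> by (simp add: P_def Out_def)
    have "card (Out u - S `` {u}) \<le> card (Out u - {v})"
      using fin v(1) by (intro card_mono) auto
    then show ?thesis using \<open>v \<in> Out u\<close> O_big[OF True] fin by simp
  next
    case False
    have "card (Out u - S `` {u}) \<le> card (Out u)" using fin by (intro card_mono) auto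
    then show ?thesis using False by simp
  qed
  have cardI: "card (In u - S `` {u}) \<le> r" for u
  proof (cases "card (In u) > r")
    case True
    then have "\<not> card (Out u) > r" using I_big[of u] by auto
    have "card {v. (v, u) \<in> D} \<ge> 2" using I_big[OF True] \<open>r \<ge> 1\<close> by (simp add: In_def)
    from T(2)[OF this] obtain w where "P u w" using True by (auto simp: P_def)
    from S_ex[OF this] obtain v where v: "(u, v) \<in> S" "P u v" by blast
    then have "v \<in> In u" using \<open>\<not> card (Out u) > r\<close> by (simp add: P_def In_def)
    have "card (In u - S `` {u}) \<le> card (In u - {v})"
      using fin v(1) by (intro card_mono) auto
    then show ?thesis using \<open>v \<in> In u\<close> I_big[OF True] fin by simp
  next
    case False
    have "card (In u - S `` {u}) \<le> card (In u)" using fin by (intro card_mono) auto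
    then show ?thesis using False by simp
  qed
  have inj_ex: "\<exists>g. g ` X \<subseteq> {..<r} \<and> inj_on g X" if "finite X" "card X \<le> r" for X :: "'v set"
    using card_le_inj[of X "{..<r}"] that by simp
  have "\<forall>u. \<exists>g. g ` (Out u - S `` {u}) \<subseteq> {..<r} \<and> inj_on g (Out u - S `` {u})"
    by (intro allI inj_ex finite_Diff fin cardO)
  from choice[OF this] obtain g where
    "\<forall>u. g u ` (Out u - S `` {u}) \<subseteq> {..<r} \<and> inj_on (g u) (Out u - S `` {u})" ..
  then have g: "g u ` (Out u - S `` {u}) \<subseteq> {..<r}" "inj_on (g u) (Out u - S `` {u})" for u
    by simp_all
  have "\<forall>u. \<exists>g. g ` (In u - S `` {u}) \<subseteq> {..<r} \<and> inj_on g (In u - S `` {u})"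
    by (intro allI inj_ex finite_Diff fin cardI)
  from choice[OF this] obtain g' where
    "\<forall>u. g' u ` (In u - S `` {u}) \<subseteq> {..<r} \<and> inj_on (g' u) (In u - S `` {u})" ..
  then have g': "g' u ` (In u - S `` {u}) \<subseteq> {..<r}" "inj_on (g' u) (In u - S `` {u})" for u
    by simp_all
  have g_lt: "g u v < r" if "(u, v) \<in> D" "(u, v) \<notin> S" for u v
    using g(1)[of u] that by (auto simp: Out_def)
  have g'_lt: "g' u v < r" if "(v, u) \<in> D" "(u, v) \<notin> S" for u v
    using g'(1)[of u] that by (auto simp: In_def)
  have g_inj: "v = w" if "g u v = g u w" "(u, v) \<in> D" "(u, v) \<notin> S" "(u, w) \<in> D" "(u, w) \<notin> S"
    for u v w
    using inj_onD[OF g(2) that(1)] that by (simp add: Out_def)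
  have g'_inj: "v = w" if "g' u v = g' u w" "(v, u) \<in> D" "(u, v) \<notin> S" "(w, u) \<in> D" "(u, w) \<notin> S"
    for u v w
    using inj_onD[OF g'(2) that(1)] that by (simp add: In_def)
  define f where "f u v = (if (u, v) \<in> S then 2 * r else if (u, v) \<in> D then g u v else r + g' u v)"
    for u v
  have kinds: "((u, v) \<in> S \<and> f u v = 2 * r) \<or>
      ((u, v) \<notin> S \<and> (u, v) \<in> D \<and> f u v = g u v \<and> f u v < r) \<or>
      ((u, v) \<notin> S \<and> (v, u) \<in> D \<and> f u v = r + g' u v \<and> r \<le> f u v \<and> f u v < 2 * r)"
    if "(u, v) \<in> A" for u v
    using that g_lt[of u v] g'_lt[of v u] asym[of u v] by (auto simp: f_def A_iff)
  have "2 * r \<le> d" by (simp add: r_def)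
  show thesis
  proof (rule that[of f])
    fix u v assume uv: "(u, v) \<in> A"
    then have vu: "(v, u) \<in> A" using assms(2) by (auto dest: symD)
    \<comment> \<open>Colour \<open>2 * r\<close> is used only on \<open>S\<close>, and
      \<open>S\<close> contains arcs of \<open>A\<close> only if \<open>d\<close> is odd.\<close>
    have "2 * r < d" if "odd d" using that by (auto simp: r_def elim: oddE)
    then show "f u v < d"
      using kinds[OF uv] S_odd[of u v] \<open>2 * r \<le> d\<close> by linarith
    show "f u v \<noteq> f v u"
      using kinds[OF uv] kinds[OF vu] S2[of u v] asym[of u v] asym[of v u] by linarith
    fix w assume uw: "(u, w) \<in> A" and eq: "f u v = f u w"
    show "v = w"
      using kinds[OF uv] kinds[OF uw]
    proof (elim disjE conjE)
      assume "(u, v) \<in> S" "(u, w) \<in> S"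
      then show "v = w" by (rule S1)
    next
      assume *: "(u, v) \<notin> S" "(u, v) \<in> D" "f u v = g u v"
        "(u, w) \<notin> S" "(u, w) \<in> D" "f u w = g u w"
      with eq have "g u v = g u w" by simp
      then show "v = w" by (rule g_inj) (fact *)+
    next
      assume *: "(u, v) \<notin> S" "(v, u) \<in> D" "f u v = r + g' u v"
        "(u, w) \<notin> S" "(w, u) \<in> D" "f u w = r + g' u w"
      with eq have "g' u v = g' u w" by simp
      then show "v = w" by (rule g'_inj) (fact *)+
    qed (use eq in linarith)+
  qed
qed

section \<open>Walks, distances and adjacency in graph powers\<close>

text \<open>Relational powers let walks be extended at either end and concatenated, which the
  subdivision arguments rely on.\<close>

lemma awalk_iff_relpow:
  assumes "pair_wf_digraph H" "x \<in> pverts H"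
  shows "(\<exists>p. pre_digraph.awalk (with_proj H) x p y \<and> length p = l) \<longleftrightarrow> (x, y) \<in> parcs H ^^ l"
proof -
  interpret W: wf_digraph "with_proj H"
    using assms(1) by (simp add: wf_digraph_wp_iff)
  show ?thesis
    using assms(2)
  proof (induction l arbitrary: x)
    case 0
    then show ?case by (auto simp: W.awalk_Nil_iff)
  next
    case (Suc l)
    have "(\<exists>p. W.awalk x p y \<and> length p = Suc l) \<longleftrightarrow>
        (\<exists>z. (x, z) \<in> parcs H \<and> (\<exists>p. W.awalk z p y \<and> length p = l))"
    proof
      assume "\<exists>p. W.awalk x p y \<and> length p = Suc l"
      then obtain e p where "W.awalk x (e # p) y" "length p = l" by (auto simp: length_Suc_conv)
      then show "\<exists>z. (x, z) \<in> parcs H \<and> (\<exists>p. W.awalk z p y \<and> length p = l)"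
        by (intro exI[of _ "snd e"]) (auto simp: W.awalk_Cons_iff)
    next
      assume "\<exists>z. (x, z) \<in> parcs H \<and> (\<exists>p. W.awalk z p y \<and> length p = l)"
      then obtain z p where "(x, z) \<in> parcs H" "W.awalk z p y" "length p = l" by blast
      then show "\<exists>p. W.awalk x p y \<and> length p = Suc l"
        by (intro exI[of _ "(x, z) # p"]) (simp add: W.awalk_Cons_iff)
    qed
    also have "\<dots> \<longleftrightarrow> (\<exists>z. (x, z) \<in> parcs H \<and> (z, y) \<in> parcs H ^^ l)"
    proof -
      have "z \<in> pverts H" if "(x, z) \<in> parcs H" for z
        using pair_wf_digraph.in_arcsD2[OF assms(1) that] .
      then show ?thesis using Suc.IH by (intro ex_cong1 conj_cong) simp_all
    qed
    also have "\<dots> \<longleftrightarrow> (x, y) \<in> parcs H ^^ Suc l"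
      by (auto intro: relpow_Suc_I2 elim: relpow_Suc_E2 simp del: relpow.simps)
    finally show ?case .
  qed
qed

lemma (in wf_digraph) awalk_cost_unit: "awalk_cost (\<lambda>_. 1) p = real (length p)"
  by (induction p)simp_all

lemma graph_dist_le_iff:
  assumes "pair_wf_digraph H" "x \<in> pverts H"
  shows "graph_dist H x y \<le> ereal (real m) \<longleftrightarrow> (\<exists>l\<le>m. (x, y) \<in> parcs H ^^ l)"
proof -
  interpret W: wf_digraph "with_proj H"
    using assms(1) by (simp add: wf_digraph_wp_iff)
  have "graph_dist H x y \<le> ereal (real m) \<longleftrightarrow> (\<exists>p. W.awalk x p y \<and> length p \<le> m)"
  proof
    assume "graph_dist H x y \<le> ereal (real m)"
    \<comment> \<open>A strict comparison of the infimum with \<open>m + 1\<close> yields a single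
      walk below that bound; its length is an integer, hence at most \<open>m\<close>.\<close>
    also have "\<dots> < ereal (real (Suc m))" by simp
    finally have "(INF p\<in>{p. W.awalk x p y}. ereal (W.awalk_cost (\<lambda>_. 1) p)) < ereal (real (Suc m))"
      unfolding graph_dist_def W.\<mu>_def .
    then obtain p where "W.awalk x p y" "ereal (W.awalk_cost (\<lambda>_. 1) p) < ereal (real (Suc m))"
      unfolding INF_less_iff by blast
    then show "\<exists>p. W.awalk x p y \<and> length p \<le> m"
      by (intro exI[of _ p]) (simp add: W.awalk_cost_unit)
  next
    assume "\<exists>p. W.awalk x p y \<and> length p \<le> m"
    then obtain p where p: "W.awalk x p y" "length p \<le> m" by blast
    show "graph_dist H x y \<le> ereal (real m)"
      unfolding graph_dist_def
      by (rule order_trans[OF W.min_cost_le_walk_cost[OF p(1)]])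
        (simp add: W.awalk_cost_unit p(2))
  qed
  then show ?thesis by (auto simp flip: awalk_iff_relpow[OF assms])
qed

lemma one_le_graph_dist:
  assumes "pair_wf_digraph H" "x \<noteq> y"
  shows "1 \<le> graph_dist H x y"
proof -
  interpret W: wf_digraph "with_proj H"
    using assms(1) by (simp add: wf_digraph_wp_iff)
  have "1 \<le> length p" if "W.awalk x p y" for p
    using that assms(2) by (cases p) (simp_all add: W.awalk_Nil_iff)
  then show ?thesis
    unfolding graph_dist_def W.\<mu>_def by (intro INF_greatest) (simp add: W.awalk_cost_unit)
qed

lemma parcs_graph_power:
  assumes "pair_wf_digraph H"
  shows "(x, y) \<in> parcs (graph_power H m) \<longleftrightarrow>
    x \<in> pverts H \<and> y \<in> pverts H \<and> x \<noteq> y \<and> (\<exists>l\<le>m. (x, y) \<in> parcs H ^^ l)"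
  using graph_dist_le_iff[OF assms] one_le_graph_dist[OF assms] by (auto simp: graph_power_def)

lemma pverts_graph_power [simp]: "pverts (graph_power H m) = pverts H"
  by (simp add: graph_power_def)

section \<open>Matching a clique with a colouring\<close>

lemma clique_card_le_colors:
  assumes "proper_coloring G k c" "clique G S"
  shows "card S \<le> k"
proof -
  have "c u \<noteq> c v" if "u \<in> S" "v \<in> S" "u \<noteq> v" for u v
    using assms that by (auto simp: proper_coloring_def clique_def)
  then have "inj_on c S" by (auto simp: inj_on_def)
  moreover have "c ` S \<subseteq> {..<k}"
    using assms by (auto simp: proper_coloring_def clique_def)
  ultimately show ?thesis using card_inj_on_le[of c S "{..<k}"] by simp
qed

text \<open>Every clique needs as many colours as it has elements, so a clique and a colouring of
  the same size are both optimal.\<close>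

lemma chromatic_number_eq_clique_number:
  assumes "finite (pverts G)" "proper_coloring G k c" "clique G S" "card S = k"
  shows "chromatic_number G = clique_number G"
proof -
  have "chromatic_number G = k"
    unfolding chromatic_number_def
  proof (rule Least_equality)
    show "\<exists>c. proper_coloring G k c" using assms(2) by blast
    show "k \<le> k'" if "\<exists>c. proper_coloring G k' c" for k'
      using that clique_card_le_colors[OF _ assms(3)] assms(4) by auto
  qed
  moreover have "finite {S. clique G S}"
    by (rule finite_subset[of _ "Pow (pverts G)"]) (use assms(1) in \<open>auto simp: clique_def\<close>)
  then have "clique_number G = k"
    unfolding clique_number_def
    using assms(3,4) clique_card_le_colors[OF assms(2)] by (intro Max_eqI) auto
  ultimately show ?thesis by simp
qed

section \<open>Points and short walks in the subdivision\<close>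

lemma sub_point_0 [simp]: "sub_point n u v 0 = Branch u"
  by (simp add: sub_point_def)

locale fractional_graph = pair_graph G for G :: "'a pair_pre_digraph" +
  fixes n :: nat
  assumes n_pos: "0 < n"
begin

abbreviation "sub \<equiv> subdivision_graph G n"
abbreviation "pt \<equiv> sub_point n"

lemma arc_sym: "(u, v) \<in> parcs G \<Longrightarrow> (v, u) \<in> parcs G"
  using sym_arcs by (auto simp: symmetric_def dest: symD)

lemma arc_neq: "(u, v) \<in> parcs G \<Longrightarrow> u \<noteq> v"
  using pair_no_loops by fastforce

sublocale sub: pair_graph sub
  by (rule pair_graph_subdivision_graph) unfold_locales

lemma sub_arc_sym: "(x, y) \<in> parcs sub \<Longrightarrow> (y, x) \<in> parcs sub"
  using sub.sym_arcs by (auto simp: symmetric_def dest: symD)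

lemma pt_arc: "(u, v) \<in> parcs G \<Longrightarrow> i < n \<Longrightarrow> (pt u v i, pt u v (Suc i)) \<in> parcs sub"
  by (auto simp: subdivision_graph_def)

lemma pt_vert:
  assumes "(u, v) \<in> parcs G" "i \<le> n"
  shows "pt u v i \<in> pverts sub"
proof (cases "i < n")
  case True
  then show ?thesis using pt_arc[OF assms(1)] sub.in_arcsD1 by blast
next
  case False
  then have "i = Suc (n - 1)" "n - 1 < n" using assms(2) n_pos by auto
  then show ?thesis using sub.in_arcsD2[OF pt_arc[OF assms(1), of "n - 1"]] by simp
qed

text \<open>An inner point determines its edge up to the direction of reading, whereas a branch
  vertex lies on every edge at it. The first alternative therefore records only that both indices
  belong to ends.\<close>

lemma pt_eq_cases:
  assumes "(u, v) \<in> parcs G" "(x, y) \<in> parcs G" "pt u v i = pt x y j" "i \<le> n" "j \<le> n"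
  shows "i \<in> {0, n} \<and> j \<in> {0, n} \<or> x = u \<and> y = v \<and> j = i \<or> x = v \<and> y = u \<and> j = n - i"
proof (cases "0 < i \<and> i < n")
  case True
  then have "0 < j \<and> j < n"
    using assms(3,5) by (auto simp: sub_point_def split: if_splits)
  then show ?thesis
    using sub_point_inj[of u v x y i n j] True assms arc_neq by auto
next
  case False
  then have "j = 0 \<or> j = n"
    using assms(3,4) by (auto simp: sub_point_def split: if_splits)
  then show ?thesis using False assms(4) by auto
qed

text \<open>Walk back to \<open>u\<close>, then out again. For \<open>v = w\<close> this may be a
  detour, but only an upper bound on the distance is wanted.\<close>

lemma fork_reach:
  assumes "(u, v) \<in> parcs G" "(u, w) \<in> parcs G" "i \<le> n" "j \<le> n"
  shows "(pt u v i, pt u w j) \<in> parcs sub ^^ (i + j)"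
proof -
  have "(Branch u, pt u w j) \<in> parcs sub ^^ j"
    using assms(4)
  proof (induction j)
    case (Suc j)
    then show ?case using pt_arc[OF assms(2), of j] by auto
  qed simp
  moreover have "(pt u v i, Branch u) \<in> parcs sub ^^ i"
    using assms(3)
  proof (induction i)
    case (Suc i)
    then show ?case using sub_arc_sym[OF pt_arc[OF assms(1), of i]]
      by (auto intro: relpow_Suc_I2 simp del: relpow.simps)
  qed simp
  ultimately show ?thesis by (auto simp: relpow_add)
qed

text \<open>With \<open>j < n\<close> the only place to change the edge is \<open>u\<close>, at
  \<open>j = 0\<close>; a point with \<open>j = n\<close> has to be renamed from the other end
  first.\<close>

lemma sub_arc_step:
  assumes "(pt u v j, y) \<in> parcs sub" "(u, v) \<in> parcs G" "j < n"
  obtains "0 < j" "y = pt u v (j - 1)" | "y = pt u v (Suc j)"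
    | b where "j = 0" "(u, b) \<in> parcs G" "y = pt u b 1"
proof -
  obtain a b t where t: "(a, b) \<in> parcs G" "t < n" "pt u v j = pt a b t" "y = pt a b (Suc t)"
    using assms(1) by (auto simp: subdivision_graph_def)
  from pt_eq_cases[OF assms(2) t(1,3)] t(2) assms(3)
  consider "j = 0" "t = 0" | "a = u" "b = v" "t = j" | "0 < j" "a = v" "b = u" "t = n - j"
    by fastforce
  then show thesis
  proof cases
    case 1
    then have "a = u" using t(3) by simp
    then show thesis using that(3)[of b] 1 t by simp
  next
    case 2
    then show thesis using that(2) t by simp
  next
    case 3
    then have "Suc t = n - (j - 1)" using assms(3) by simp
    then have "y = pt u v (j - 1)"
      using t(4) 3 assms(3) sub_point_flip[of "j - 1" n v u] by simp
    then show thesis using that(1) 3 by simp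
  qed
qed

text \<open>A walk shorter than \<open>n\<close> passes at most one branch vertex.\<close>

lemma short_walk_cases:
  assumes "(x, y) \<in> parcs sub ^^ l" "l < n"
  shows "x = y \<or>
    (\<exists>u v i j. (u, v) \<in> parcs G \<and> i \<le> n \<and> j \<le> n \<and> i \<le> j + l \<and> j \<le> i + l \<and>
       x = pt u v i \<and> y = pt u v j) \<or>
    (\<exists>u v w i j. (u, v) \<in> parcs G \<and> (u, w) \<in> parcs G \<and> i \<le> n \<and> j \<le> n \<and> i + j \<le> l \<and>
       x = pt u v i \<and> y = pt u w j)"
  (is "_ \<or> ?same l x y \<or> ?fork l x y")
  using assms
proof (induction l arbitrary: y)
  case (Suc l)
  obtain z where z: "(x, z) \<in> parcs sub ^^ l" "(z, y) \<in> parcs sub"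
    using Suc.prems(1) by auto
  have "l < n" using Suc.prems(2) by simp
  from Suc.IH[OF z(1) this] show ?case
  proof (elim disjE)
    assume "x = z"
    then obtain u v i where "(u, v) \<in> parcs G" "i < n" "x = pt u v i" "y = pt u v (Suc i)"
      using z(2) by (auto simp: subdivision_graph_def)
    then have "?same (Suc l) x y"
      by (intro exI[of _ u] exI[of _ v] exI[of _ i] exI[of _ "Suc i"]) auto
    then show ?thesis by (rule disjI2[OF disjI1])
  next
    assume "?same l x z"
    then obtain u v i j where *: "(u, v) \<in> parcs G" "i \<le> n" "j \<le> n" "i \<le> j + l" "j \<le> i + l"
       "x = pt u v i" "z = pt u v j"
      by blast
    \<comment> \<open>If \<open>j = n\<close>, reading the edge from \<open>v\<close> turns the
      index of \<open>z\<close> into 0, so that \<open>sub_arc_step\<close> applies.\<close>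
    obtain u v i j where uv: "(u, v) \<in> parcs G" "i \<le> n" "j < n" "i \<le> j + l" "j \<le> i + l"
       "x = pt u v i" "z = pt u v j"
    proof (cases "j < n")
      case True
      then show thesis using that * by blast
    next
      case False
      then have "j = n" using *(3) by simp
      have "x = pt v u (n - i)" "z = pt v u (n - n)"
        using sub_point_flip[of i n v u] sub_point_flip[of n n v u] * \<open>j = n\<close> n_pos by simp_all
      then show thesis
        using that[of v u "n - i" 0] * arc_sym n_pos \<open>j = n\<close> by simp
    qed
    from z(2)[unfolded uv(7)] uv(1,3) show ?thesis
    proof (cases rule: sub_arc_step)
      case 1
      have "?same (Suc l) x y"
        by (rule exI[of _ u], rule exI[of _ v], rule exI[of _ i], rule exI[of _ "j - 1"])
          (use uv 1 in auto)
      then show ?thesis by (rule disjI2[OF disjI1])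
    next
      case 2
      have "?same (Suc l) x y"
        by (rule exI[of _ u], rule exI[of _ v], rule exI[of _ i], rule exI[of _ "Suc j"])
          (use uv 2 in auto)
      then show ?thesis by (rule disjI2[OF disjI1])
    next
      case (3 b)
      \<comment> \<open>The walk leaves the edge through \<open>Branch u\<close>. As
        \<open>j = 0\<close>, the old bound gives \<open>i <= l\<close>, hence
        \<open>i + 1 <= Suc l\<close>.\<close>
      have "?fork (Suc l) x y"
        by (rule exI[of _ u], rule exI[of _ v], rule exI[of _ b], rule exI[of _ i],
            rule exI[of _ 1])
          (use uv 3 n_pos in auto)
      then show ?thesis by (rule disjI2[OF disjI2])
    qed
  next
    assume "?fork l x z"
    then obtain u v w i j where uv: "(u, v) \<in> parcs G" "(u, w) \<in> parcs G" "i \<le> n" "j \<le> n"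
      "i + j \<le> l" "x = pt u v i" "z = pt u w j"
      by blast
    have "j < n" using uv Suc.prems(2) by simp
    from z(2)[unfolded uv(7)] uv(2) this show ?thesis
    proof (cases rule: sub_arc_step)
      case 1
      have "?fork (Suc l) x y"
        by (rule exI[of _ u], rule exI[of _ v], rule exI[of _ w], rule exI[of _ i],
            rule exI[of _ "j - 1"]) (use uv 1 in auto)
      then show ?thesis by (rule disjI2[OF disjI2])
    next
      case 2
      have "?fork (Suc l) x y"
        by (rule exI[of _ u], rule exI[of _ v], rule exI[of _ w], rule exI[of _ i],
            rule exI[of _ "Suc j"]) (use uv 2 \<open>j < n\<close> in auto)
      then show ?thesis by (rule disjI2[OF disjI2])
    next
      case (3 b)
      have "?fork (Suc l) x y"
        by (rule exI[of _ u], rule exI[of _ v], rule exI[of _ b], rule exI[of _ i],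
            rule exI[of _ 1])
          (use uv 3 n_pos in auto)
      then show ?thesis by (rule disjI2[OF disjI2])
    qed
  qed
qed simp

end

section \<open>The colour of a point\<close>

text \<open>The offset \<open>1 + m mod 2\<close> reserves colour 0 for branch vertices and, if
  \<open>m\<close> is odd, colour 1 for midpoints; the last case arises only then. The block number
  \<open>m - i\<close> is the distance \<open>m + 1 - i\<close> to \<open>v\<close>, minus
  one.\<close>

definition point_color :: "nat \<Rightarrow> nat \<Rightarrow> ('a \<Rightarrow> 'a \<Rightarrow> nat) \<Rightarrow> 'a \<Rightarrow> 'a \<Rightarrow> nat \<Rightarrow> nat" where
  "point_color m d f u v i =
     (if i = 0 \<or> i = m + 1 then 0
      else if i \<le> m div 2 then 1 + m mod 2 + ((i - 1) * d + f u v)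
      else if m + 1 - i \<le> m div 2 then 1 + m mod 2 + ((m - i) * d + f v u)
      else 1)"

text \<open>Reversal exchanges the near and the far case, which exclude each other, so the colour
  does not depend on the direction in which an edge is read.\<close>

lemma point_color_flip:
  assumes "i \<le> m + 1"
  shows "point_color m d f v u (m + 1 - i) = point_color m d f u v i"
proof -
  have "\<not> (i \<le> m div 2 \<and> m + 1 - i \<le> m div 2)" using assms by linarith
  moreover have "m + 1 - i - 1 = m - i" "m + 1 - (m + 1 - i) = i" "m - (m + 1 - i) = i - 1"
    using assms by auto
  moreover have "m + 1 - i = 0 \<longleftrightarrow> i = m + 1" "m + 1 - i = m + 1 \<longleftrightarrow> i = 0"
    using assms by auto
  ultimately show ?thesis unfolding point_color_def by auto
qed

lemma point_color_ends: "point_color m d f u v 0 = 0" "point_color m d f u v (Suc m) = 0"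
  by (simp_all add: point_color_def)

lemma point_color_pos:
  assumes "0 < i" "i \<le> m"
  shows "0 < point_color m d f u v i"
  using assms by (simp add: point_color_def)

lemma point_color_near:
  assumes "0 < i" "i \<le> m div 2"
  shows "point_color m d f u v i = 1 + m mod 2 + ((i - 1) * d + f u v)"
  using assms by (auto simp: point_color_def)

lemma point_color_far:
  assumes "0 < i" "i \<le> m div 2"
  shows "point_color m d f u v (Suc m - i) = 1 + m mod 2 + ((i - 1) * d + f v u)"
proof -
  have "i \<le> m + 1" using assms by linarith
  then show ?thesis
    using point_color_flip[of i m d f u v] point_color_near[OF assms, of d f v u] by simp
qed

lemma point_color_mid:
  assumes "m div 2 < i" "m div 2 < m + 1 - i"
  shows "point_color m d f u v i = 1" "i = m div 2 + 1" "m mod 2 = 1"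
proof -
  show "i = m div 2 + 1" "m mod 2 = 1"
    using assms mult_div_mod_eq[of 2 m] mod_less_divisor[of 2 m] by linarith+
  show "point_color m d f u v i = 1" using assms by (auto simp: point_color_def)
qed

lemma point_kinds:
  fixes i m :: nat
  assumes "0 < i" "i \<le> m"
  obtains (near) "i \<le> m div 2"
    | (far) i' where "i = m + 1 - i'" "0 < i'" "i' \<le> m div 2"
    | (mid) "m div 2 < i" "m div 2 < m + 1 - i"
proof (cases "i \<le> m div 2 \<or> m div 2 < m + 1 - i")
  case True
  then show thesis using near mid by linarith
next
  case False
  then show thesis using far[of "m + 1 - i"] assms by simp
qed

text \<open>Uniqueness of quotient and remainder: a colour reveals its block and its place
  there.\<close>

lemma block_eq:
  fixes d a b x y :: nat
  assumes "a * d + x = b * d + y" "x < d" "y < d"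
  shows "a = b \<and> x = y"
proof -
  have "(a * d + x) div d = (b * d + y) div d" "(a * d + x) mod d = (b * d + y) mod d"
    using assms(1) by simp_all
  then show ?thesis using assms(2,3) by simp
qed

context fractional_graph
begin

text \<open>This makes the colouring well defined on points with several names. All branch vertices
  share colour 0, so the coarse end case of \<open>pt_eq_cases\<close> suffices.\<close>

lemma point_color_eqI:
  assumes n: "n = m + 1"
    and a: "(u, v) \<in> parcs G" "(x, y) \<in> parcs G" "pt u v i = pt x y j" "i \<le> n" "j \<le> n"
  shows "point_color m d f u v i = point_color m d f x y j"
  using pt_eq_cases[OF a]
proof (elim disjE conjE)
  assume "i \<in> {0, n}" "j \<in> {0, n}"
  then show ?thesis using n by (auto simp: point_color_ends)
next
  assume "x = v" "y = u" "j = n - i"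
  then show ?thesis using n a(4) point_color_flip[of i m d f v u] by simp
qed simp

section \<open>Properness of the colouring\<close>

context
  fixes m d :: nat and f :: "'a \<Rightarrow> 'a \<Rightarrow> nat"
  assumes n: "n = m + 1" and m: "m \<ge> 1"
    and f_lt: "\<And>u v. (u, v) \<in> parcs G \<Longrightarrow> f u v < d"
    and f_inj: "\<And>u v w. (u, v) \<in> parcs G \<Longrightarrow> (u, w) \<in> parcs G \<Longrightarrow> f u v = f u w \<Longrightarrow> v = w"
    and f_neq: "\<And>u v. (u, v) \<in> parcs G \<Longrightarrow> f u v \<noteq> f v u"
begin

lemma point_color_lt:
  assumes "(u, v) \<in> parcs G" "i \<le> n"
  shows "point_color m d f u v i < 1 + m mod 2 + m div 2 * d"
proof -
  have bound: "(i - 1) * d + c < m div 2 * d" if "0 < i" "i \<le> m div 2" "c < d" for i c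
  proof -
    have "(i - 1) * d + c < (i - 1) * d + d" using that by simp
    also have "\<dots> = i * d" using that(1) by (cases i) simp_all
    also have "\<dots> \<le> m div 2 * d" using that(2) by (rule mult_le_mono1)
    finally show ?thesis .
  qed
  show ?thesis
  proof (cases "0 < i \<and> i \<le> m")
    case False
    then have "i = 0 \<or> i = m + 1" using assms(2) n by auto
    then show ?thesis using point_color_ends[of m d f u v] by auto
  next
    case True
    then have "0 < i" "i \<le> m" by auto
    then show ?thesis
    proof (cases rule: point_kinds)
      case near
      then show ?thesis
        using bound[of i "f u v"] f_lt[OF assms(1)] \<open>0 < i\<close>
        by (simp add: point_color_near)
    next
      case (far i')
      then show ?thesis
        using bound[of i' "f v u"] f_lt[OF arc_sym[OF assms(1)]]
        by (simp add: point_color_far)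
    next
      case mid
      from point_color_mid(1)[OF this, of d f u v] point_color_mid(3)[OF this] show ?thesis
        by simp
    qed
  qed
qed

text \<open>The two ends of the edge are \<open>m + 1\<close> apart and thus excluded. Inner points
  at different distances from their nearer ends get different blocks or the midpoint colour; at
  equal distances from opposite ends, \<open>f u v\<close> and \<open>f v u\<close> separate
  them.\<close>

lemma point_color_same:
  assumes "(u, v) \<in> parcs G" "i \<le> n" "j \<le> n" "i \<noteq> j" "i \<le> j + m" "j \<le> i + m"
  shows "point_color m d f u v i \<noteq> point_color m d f u v j"
proof (cases "0 < i \<and> i \<le> m \<and> 0 < j \<and> j \<le> m")
  case False
  then consider "i = 0 \<or> i = m + 1" "j = 0 \<or> j = m + 1" | "i = 0 \<or> i = m + 1" "0 < j" "j \<le> m"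
    | "0 < i" "i \<le> m" "j = 0 \<or> j = m + 1"
    using assms(2,3) n by linarith
  then show ?thesis
  proof cases
    case 1
    then show ?thesis using assms(4-6) by auto
  next
    case 2
    then show ?thesis using point_color_pos[of j m d f u v] point_color_ends[of m d f u v] by auto
  next
    case 3
    then show ?thesis using point_color_pos[of i m d f u v] point_color_ends[of m d f u v] by auto
  qed
next
  case True
  have vu: "(v, u) \<in> parcs G" using arc_sym assms(1) .
  have blocks: "(a - 1) * d + f x y \<noteq> (b - 1) * d + f z w"
    if "(x, y) \<in> parcs G" "(z, w) \<in> parcs G" "0 < a" "0 < b" "a \<noteq> b \<or> f x y \<noteq> f z w" for a b x y z w
  proof
    assume eq: "(a - 1) * d + f x y = (b - 1) * d + f z w"
    show False using block_eq[OF eq f_lt[OF that(1)] f_lt[OF that(2)]] that(3-5) by auto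
  qed
  note B = blocks[OF assms(1) assms(1)] blocks[OF assms(1) vu]
    blocks[OF vu assms(1)] blocks[OF vu vu]
  have "0 < i" "i \<le> m" "0 < j" "j \<le> m" using True by auto
  from this(1,2) show ?thesis
  proof (cases rule: point_kinds)
    case near
    from \<open>0 < j\<close> \<open>j \<le> m\<close> show ?thesis
    proof (cases rule: point_kinds)
      case near': near
      then show ?thesis
        using B(1)[of i j] near True assms(4)
        by (simp add: point_color_near)
    next
      case (far j')
      then show ?thesis
        using B(2)[of i j'] near True f_neq[OF assms(1)]
        by (simp add: point_color_near point_color_far)
    next
      case mid
      then show ?thesis
        using point_color_mid(1)[OF mid, of d f u v] point_color_mid(3)[OF mid] near True
        by (simp add: point_color_near)
    qed
  next
    case (far i')
    from \<open>0 < j\<close> \<open>j \<le> m\<close> show ?thesis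
    proof (cases rule: point_kinds)
      case near
      then show ?thesis
        using B(3)[of i' j] far True f_neq[OF vu]
        by (simp add: point_color_near point_color_far)
    next
      case far': (far j')
      then show ?thesis
        using B(4)[of i' j'] far far' assms(4)
        by (auto simp: point_color_far)
    next
      case mid
      then show ?thesis
        using point_color_mid(1)[OF mid, of d f u v] point_color_mid(3)[OF mid] far True
        by (simp add: point_color_far)
    qed
  next
    case mid
    note I = point_color_mid(1)[OF mid, of d f u v] point_color_mid(3)[OF mid]
    from \<open>0 < j\<close> \<open>j \<le> m\<close> show ?thesis
    proof (cases rule: point_kinds)
      case near
      then show ?thesis using I True by (simp add: point_color_near)
    next
      case (far j')
      then show ?thesis using I True by (simp add: point_color_far)
    next
      case mid': mid
      then show ?thesis using point_color_mid(2)[OF mid] point_color_mid(2)[OF mid'] assms(4)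
        by simp
    qed
  qed
qed

text \<open>By \<open>i <= j\<close> the first point is near \<open>u\<close>. If the second is near
  \<open>u\<close> too, equal colours would force \<open>v = w\<close> by \<open>f_inj\<close>; if
  it is near \<open>w\<close>, the blocks differ.\<close>

lemma point_color_fork_le:
  assumes "(u, v) \<in> parcs G" "(u, w) \<in> parcs G" "v \<noteq> w" "i \<le> j" "i + j \<le> m" "0 < i"
  shows "point_color m d f u v i \<noteq> point_color m d f u w j"
proof -
  have near: "i \<le> m div 2" using assms(4,5) by linarith
  have wu: "(w, u) \<in> parcs G" using arc_sym assms(2) .
  have "0 < j" "j \<le> m" using assms by auto
  then show ?thesis
  proof (cases rule: point_kinds)
    case near': near
    have "(i - 1) * d + f u v \<noteq> (j - 1) * d + f u w"
      using block_eq[of "i - 1" d "f u v" "j - 1" "f u w"] f_lt f_inj assms(1-3) by blast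
    then show ?thesis using near near' \<open>0 < i\<close> \<open>0 < j\<close> by (simp add: point_color_near)
  next
    case (far j')
    \<comment> \<open>From \<open>j = m + 1 - j'\<close> and \<open>i + j <= m\<close> follows
      \<open>i < j'\<close>.\<close>
    then have "i - 1 \<noteq> j' - 1" using assms by linarith
    then have "(i - 1) * d + f u v \<noteq> (j' - 1) * d + f w u"
      using block_eq[of "i - 1" d "f u v" "j' - 1" "f w u"] f_lt assms(1) wu by blast
    then show ?thesis using near far \<open>0 < i\<close> by (simp add: point_color_near point_color_far)
  next
    case mid
    then show ?thesis
      using point_color_mid(1)[OF mid, of d f u w] point_color_mid(3)[OF mid] near \<open>0 < i\<close>
      by (simp add: point_color_near)
  qed
qed

lemma point_color_fork:
  assumes "(u, v) \<in> parcs G" "(u, w) \<in> parcs G" "v \<noteq> w" "i + j \<le> m" "0 < i \<or> 0 < j"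
  shows "point_color m d f u v i \<noteq> point_color m d f u w j"
proof (cases "0 < i \<and> 0 < j")
  case True
  show ?thesis
  proof (cases "i \<le> j")
    case ij: True
    show ?thesis by (rule point_color_fork_le) (use assms ij True in simp_all)
  next
    case ij: False
    have "point_color m d f u w j \<noteq> point_color m d f u v i"
      by (rule point_color_fork_le) (use assms ij True in simp_all)
    then show ?thesis by simp
  qed
next
  case False
  then consider "i = 0" "0 < j" "j \<le> m" | "j = 0" "0 < i" "i \<le> m"
    using assms(4,5) by linarith
  then show ?thesis
    using point_color_pos[of i m d f u v] point_color_pos[of j m d f u w]
    by cases (simp_all add: point_color_ends)
qed

lemma ex_proper_coloring:
  "\<exists>c. proper_coloring (graph_power sub m) (1 + m mod 2 + m div 2 * d) c"
proof -
  \<comment> \<open>\<open>R\<close> relates a point to the colours of all its names; by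
    \<open>point_color_eqI\<close> these agree.\<close>
  define R where "R x k \<longleftrightarrow> (\<exists>u v i. (u, v) \<in> parcs G \<and> i \<le> n \<and> x = pt u v i \<and>
      k = point_color m d f u v i)"
    for x k
  \<comment> \<open>The default 0 is for points on no edge, such as isolated branch
    vertices.\<close>
  define c where "c x = (if \<exists>k. R x k then SOME k. R x k else 0)" for x
  have R_c: "R x (c x)" if "R x k" for x k
    using someI[of "R x", OF that] that by (auto simp: c_def)
  have c_pt: "c (pt u v i) = point_color m d f u v i" if "(u, v) \<in> parcs G" "i \<le> n" for u v i
  proof -
    have "R (pt u v i) (point_color m d f u v i)" using that by (auto simp: R_def)
    then have "R (pt u v i) (c (pt u v i))" by (rule R_c)
    then obtain x y j where *: "(x, y) \<in> parcs G" "j \<le> n" "pt u v i = pt x y j"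
      "c (pt u v i) = point_color m d f x y j"
      unfolding R_def by blast
    then show ?thesis using point_color_eqI[OF n that(1) *(1,3) that(2) *(2), of d f] by simp
  qed
  have lt: "c x < 1 + m mod 2 + m div 2 * d" for x
  proof (cases "\<exists>k. R x k")
    case True
    then have "R x (c x)" using R_c by blast
    then obtain u v i where "(u, v) \<in> parcs G" "i \<le> n" "c x = point_color m d f u v i"
      unfolding R_def by blast
    then show ?thesis using point_color_lt[of u v i] by simp
  next
    case False
    then show ?thesis by (simp add: c_def)
  qed
  have neq: "c x \<noteq> c y" if xy: "(x, y) \<in> parcs (graph_power sub m)" for x y
  proof -
    obtain l where l: "x \<noteq> y" "l \<le> m" "(x, y) \<in> parcs sub ^^ l"
      using xy parcs_graph_power[OF sub.pair_wf_digraph_axioms] by blast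
    have "l < n" using l(2) n by simp
    have same: "c x \<noteq> c y" if "(u, v) \<in> parcs G" "i \<le> n" "j \<le> n" "i \<le> j + l" "j \<le> i + l"
      "x = pt u v i" "y = pt u v j" for u v i j
    proof -
      have "i \<noteq> j" using l(1) that by auto
      then show ?thesis using point_color_same[OF that(1-3)] that l(2) c_pt by simp
    qed
    have fork: "c x \<noteq> c y" if "(u, v) \<in> parcs G" "(u, w) \<in> parcs G" "i \<le> n" "j \<le> n" "i + j \<le> l"
      "x = pt u v i" "y = pt u w j" for u v w i j
    proof (cases "v = w")
      case True
      then show ?thesis using same[of u v i j] that by simp
    next
      case False
      have "0 < i \<or> 0 < j"
      proof (rule ccontr)
        assume "\<not> ?thesis"
        then have "x = y" using that(6,7) by simp
        then show False using l(1) by simp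
      qed
      then show ?thesis using point_color_fork[OF that(1,2) False, of i j] that l(2) c_pt by simp
    qed
    from short_walk_cases[OF l(3) \<open>l < n\<close>] show ?thesis
    proof (elim disjE exE conjE)
      assume "x = y"
      with l(1) show ?thesis by simp
    qed (rule same fork, assumption+)+
  qed
  show ?thesis
    unfolding proper_coloring_def using lt neq by blast
qed

end

section \<open>A clique around a vertex\<close>

lemma ex_clique:
  assumes n: "n = m + 1" and m: "m \<ge> 1" and d: "card {v. (u, v) \<in> parcs G} = d" "d \<ge> 1"
  shows "\<exists>Q. clique (graph_power sub m) Q \<and> card Q = 1 + m mod 2 + m div 2 * d"
proof -
  define N where "N = {v. (u, v) \<in> parcs G}"
  define k where "k = m div 2"
  have cardN: "card N = d" using d(1) by (simp add: N_def)
  then have "finite N" "N \<noteq> {}" using d(2) card.infinite by force+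
  then obtain a where "a \<in> N" by blast
  \<comment> \<open>Index 0 stands for \<open>u\<close> and index \<open>k + 1\<close> for the
    midpoint of the edge \<open>ua\<close>. Both are named only on the edge to \<open>a\<close>, so
    that each occurs once.\<close>
  define M where "M = (if odd m then {0, k + 1} else {0})"
  define X where "X = N \<times> {1..k} \<union> {a} \<times> M"
  have k: "2 * k \<le> m" "odd m \<Longrightarrow> m = 2 * k + 1" by (simp_all add: k_def)
  have "card M = 1 + m mod 2" by (simp add: M_def odd_iff_mod_2_eq_one)
  moreover have "card X = card (N \<times> {1..k}) + card ({a} \<times> M)"
    unfolding X_def using \<open>finite N\<close> by (intro card_Un_disjoint) (auto simp: M_def)
  ultimately have cardX: "card X = 1 + m mod 2 + m div 2 * d"
    by (simp add: card_cartesian_product cardN k_def)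
  have X: "v \<in> N \<and> (0 < i \<and> i \<le> k \<or> v = a \<and> i = 0 \<or> v = a \<and> i = k + 1 \<and> m = 2 * k + 1)"
    if "(v, i) \<in> X" for v i
    using that \<open>a \<in> N\<close> k(2) by (auto simp: X_def M_def split: if_splits)
  have X_N: "v \<in> N" "i \<le> m" if "(v, i) \<in> X" for v i
    using X[OF that] k(1) m by (blast, linarith)
  \<comment> \<open>Only the midpoint has an index above \<open>k\<close>, and it occurs once and
    only if \<open>m = 2 * k + 1\<close>. A sum involving it is at most
    \<open>(k + 1) + k = m\<close>, any other at most \<open>2 * k\<close>.\<close>
  have X_sum: "i + j \<le> m" if "(v, i) \<in> X" "(w, j) \<in> X" "(v, i) \<noteq> (w, j)" for v w i j
  proof -
    have "v \<noteq> w \<or> i \<noteq> j" using that(3) by simp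
    then show ?thesis using X[OF that(1)] X[OF that(2)] k(1) m by auto
  qed
  have X_0: "v = a" if "(v, 0) \<in> X" for v
    using that by (auto simp: X_def)
  have inj: "inj_on (\<lambda>(v, i). pt u v i) X"
  proof (rule inj_onI, clarify)
    fix v i w j assume vi: "(v, i) \<in> X" and wj: "(w, j) \<in> X" and eq: "pt u v i = pt u w j"
    have A: "(u, v) \<in> parcs G" "(u, w) \<in> parcs G" "i < n" "j < n"
      using X_N[OF vi] X_N[OF wj] n by (auto simp: N_def)
    have "u \<noteq> w" using A arc_neq by blast
    \<comment> \<open>Indices stay below \<open>n\<close>, so an end can only be \<open>u\<close>
      itself, which \<open>X\<close> names just once.\<close>
    from pt_eq_cases[OF A(1,2) eq] A(3,4) \<open>u \<noteq> w\<close> have "i = 0 \<and> j = 0 \<or> v = w \<and> i = j"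
      by auto
    then show "v = w \<and> i = j" using X_0 vi wj by blast
  qed
  let ?Q = "(\<lambda>(v, i). pt u v i) ` X"
  have "clique (graph_power sub m) ?Q"
    unfolding clique_def
  proof (intro conjI ballI impI)
    show "?Q \<subseteq> pverts (graph_power sub m)"
    proof (clarsimp)
      fix v i assume "(v, i) \<in> X"
      then show "pt u v i \<in> pverts sub" using X_N[of v i] n by (intro pt_vert) (simp_all add: N_def)
    qed
  next
    fix x y assume "x \<in> ?Q" "y \<in> ?Q" "x \<noteq> y"
    then obtain v i w j where *: "(v, i) \<in> X" "x = pt u v i" "(w, j) \<in> X" "y = pt u w j" by auto
    have A: "(u, v) \<in> parcs G" "(u, w) \<in> parcs G" "i \<le> n" "j \<le> n"
      using X_N[OF *(1)] X_N[OF *(3)] n by (auto simp: N_def)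
    have "(v, i) \<noteq> (w, j)" using * \<open>x \<noteq> y\<close> by auto
    then have "i + j \<le> m" using X_sum * by blast
    moreover have "(x, y) \<in> parcs sub ^^ (i + j)" using fork_reach[OF A] * by simp
    ultimately show "(x, y) \<in> parcs (graph_power sub m)"
      using pt_vert A * \<open>x \<noteq> y\<close> parcs_graph_power[OF sub.pair_wf_digraph_axioms] by blast
  qed
  then show ?thesis using card_image[OF inj] cardX by (intro exI[of _ ?Q]) simp
qed

end

theorem theorem4:
  fixes G :: "'a pair_pre_digraph" and m :: nat
  assumes "pair_graph G"
    and "Digraph_Component.connected (with_proj G)"
    and "max_degree G \<ge> 3"
    and "m \<ge> 1"
  shows "chromatic_number (fractional_power G m (m + 1)) =
         clique_number (fractional_power G m (m + 1))"
proof -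
  interpret pair_graph G by fact
  interpret fractional_graph G "m + 1" by unfold_locales simp
  have "pverts G \<noteq> {}"
    using assms(2) by (auto simp: Digraph_Component.connected_def strongly_connected_def)
  have deg: "out_degree (with_proj G) u = card {v. (u, v) \<in> parcs G}" for u
    unfolding out_degree_def
    by (rule bij_betw_same_card[of snd]) (force simp: bij_betw_def inj_on_def out_arcs_def)
  let ?d = "max_degree G"
  have "?d \<in> out_degree (with_proj G) ` pverts G"
    unfolding max_degree_def using \<open>pverts G \<noteq> {}\<close> pair_finite_verts by (intro Max_in) auto
  then obtain u where u: "card {v. (u, v) \<in> parcs G} = ?d" using deg by auto
  \<comment> \<open>\<open>half_edge_coloring\<close> asks for the degree bound at every
    \<open>w\<close>, also outside the vertex set, where no arcs start.\<close>
  have le: "card {v. (w, v) \<in> parcs G} \<le> ?d" for w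
  proof (cases "w \<in> pverts G")
    case True
    then show ?thesis
      unfolding max_degree_def deg[symmetric] using pair_finite_verts by simp
  next
    case False
    then have "{v. (w, v) \<in> parcs G} = {}" using in_arcsD1 by auto
    then show ?thesis by simp
  qed
  have "sym (parcs G)" "irrefl (parcs G)"
    using arc_sym arc_neq by (auto simp: sym_def irrefl_def)
  moreover have "?d \<ge> 2" using assms(3) by simp
  ultimately obtain f where f: "\<And>u v. (u, v) \<in> parcs G \<Longrightarrow> f u v < ?d"
    "\<And>u v w. (u, v) \<in> parcs G \<Longrightarrow> (u, w) \<in> parcs G \<Longrightarrow> f u v = f u w \<Longrightarrow> v = w"
    "\<And>u v. (u, v) \<in> parcs G \<Longrightarrow> f u v \<noteq> f v u"
    using half_edge_coloring[OF pair_finite_arcs _ _ _ le] by blast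
  have "\<exists>c. proper_coloring (graph_power sub m) (1 + m mod 2 + m div 2 * ?d) c"
    by (rule ex_proper_coloring[OF refl assms(4)]) (fact f)+
  then obtain c where "proper_coloring (graph_power sub m) (1 + m mod 2 + m div 2 * ?d) c"
    by blast
  moreover obtain Q where "clique (graph_power sub m) Q" "card Q = 1 + m mod 2 + m div 2 * ?d"
    using ex_clique[OF refl assms(4) u] assms(3) by auto
  ultimately show ?thesis
    unfolding fractional_power_def
    using sub.pair_finite_verts by (intro chromatic_number_eq_clique_number) auto
qed

end
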